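(* Let $n \ge 1$, with red tanks $R_1, \ldots, R_n$ each initially containing $1$ unit of water and blue tanks $B_1, \ldots, B_n$ each initially empty. Consider the strategy: for $i = 1, \ldots, n$ (in order), for $j = 1, \ldots, n$ (in order), equilibrate $R_i$ and $B_j$. Then the total amount of water in the blue tanks at the end of this strategy is at least as large as the total amount in the blue tanks at the end of any finite sequence of pairwise equilibrations applied to the same initial configuration.
   Context: Equilibrating two tanks $a \neq b$ with water levels $x_a, x_b$ replaces both levels by $\frac{x_a+x_b}{2}$ and leaves all other tanks unchanged. *)

theory Defs
  imports Complex_Main
begin

datatype tank = Red nat | Blue nat

definition tanks :: "nat \<Rightarrow> tank set" where
  "tanks n = Red ` {1..n} \<union> Blue ` {1..n}"

definition equil :: "tank \<Rightarrow> tank \<Rightarrow> (tank \<Rightarrow> real) \<Rightarrow> (tank \<Rightarrow> real)" where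
  "equil a b x = x(a := (x a + x b) / 2, b := (x a + x b) / 2)"

definition run :: "(tank \<times> tank) list \<Rightarrow> (tank \<Rightarrow> real) \<Rightarrow> (tank \<Rightarrow> real)" where
  "run ops x = foldl (\<lambda>y (a, b). equil a b y) x ops"

definition init :: "tank \<Rightarrow> real" where
  "init t = (case t of Red _ \<Rightarrow> 1 | Blue _ \<Rightarrow> 0)"

definition blue_total :: "nat \<Rightarrow> (tank \<Rightarrow> real) \<Rightarrow> real" where
  "blue_total n x = (\<Sum>j=1..n. x (Blue j))"

definition strategy :: "nat \<Rightarrow> (tank \<times> tank) list" where
  "strategy n = concat (map (\<lambda>i. map (\<lambda>j. (Red i, Blue j)) [1..<n+1]) [1..<n+1])"

end

theory Submission
  imports Defs
begin

text \<open>
  List the tanks from top to bottom and, as long as some red tank stands immediately above a blue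
  one, equilibrate the two and exchange their places. The red total \<open>F\<close> reached when all blue tanks
  are on top depends only on the list and the levels. Its coefficients increase from top to bottom,
  because averaging neighbours preserves this; hence, for given levels, \<open>F\<close> is smallest when the
  list is sorted by decreasing level. After equilibrating \<open>a\<close> and \<open>b\<close> there is a sorted list in
  which they are neighbours, in either order. With red above blue both have the same coefficient, and
  with equal colours and the fuller tank on top the move can only have increased \<open>F\<close>. So the minimum of
  \<open>F\<close> over all lists never decreases. It bounds the red total from below, and the strategy
  attains its initial value, as it carries out the exchanges for \<open>R\<^sub>n, \<dots>, R\<^sub>1, B\<^sub>1, \<dots>, B\<^sub>n\<close>.
\<close>

section \<open>The red total reached by sinking the red tanks\<close>

fun sink :: "real \<Rightarrow> real list \<Rightarrow> real list \<times> real" where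
  "sink v [] = ([], v)"
| "sink v (b # bs) =
    (let m = (v + b) / 2; s = sink m bs in (m # fst s, snd s))"

text \<open>
  A list of tanks is given as pairs (is red, level), top first; the result consists of the final
  blue levels and the final red total.
\<close>

fun settle :: "(bool \<times> real) list \<Rightarrow> real list \<times> real" where
  "settle [] = ([], 0)"
| "settle ((red, v) # l) =
    (let t = settle l in
      if red then (let s = sink v (fst t) in (fst s, snd t + snd s))
      else (v # fst t, snd t))"

lemma settle_append_cong:
  "settle l = settle l' \<Longrightarrow> settle (p @ l) = settle (p @ l')"
  by (induction p) auto

text \<open>The red tank meets the blue one directly below it first and goes on with the mean, so
  \<open>settle\<close> cannot tell whether this exchange has already been made.\<close>

lemma settle_red_blue:
  assumes "m = (u + v) / 2"
  shows "settle (p @ (True, u) # (False, v) # q) = settle (p @ (False, m) # (True, m) # q)"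
  by (rule settle_append_cong) (simp add: Let_def assms)

text \<open>
  Domination of all prefix sums, where \<open>d\<close> is the difference of the prefix sums accumulated so far;
  the red total counts as the last entry, and the overall sums agree.
\<close>

fun dominates :: "real \<Rightarrow> real list \<Rightarrow> real \<Rightarrow> real list \<Rightarrow> real \<Rightarrow> bool" where
  "dominates d [] r [] r' \<longleftrightarrow> 0 \<le> d \<and> d + r = r'"
| "dominates d (b # bs) r (b' # bs') r' \<longleftrightarrow> 0 \<le> d \<and> dominates (d + b - b') bs r bs' r'"
| "dominates d _ r _ r' \<longleftrightarrow> False"

fun word_dominates :: "real \<Rightarrow> (bool \<times> real) list \<Rightarrow> (bool \<times> real) list \<Rightarrow> bool" where
  "word_dominates d [] [] \<longleftrightarrow> d = 0"
| "word_dominates d ((k, v) # l) ((k', v') # l') \<longleftrightarrow>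
    0 \<le> d \<and> k = k' \<and> word_dominates (d + v - v') l l'"
| "word_dominates d _ _ \<longleftrightarrow> False"

lemma dominates_nonneg: "dominates d bs r bs' r' \<Longrightarrow> 0 \<le> d"
  by (cases "(d, bs, r, bs', r')" rule: dominates.cases) auto

lemma dominates_imp_le: "dominates d bs r bs' r' \<Longrightarrow> r \<le> r'"
  by (induction d bs r bs' r' rule: dominates.induct) auto

text \<open>Each passage replaces the prefix difference inside the pair by the mean of the
  differences above and below it, so none becomes negative.\<close>

lemma dominates_sink:
  assumes "0 \<le> d" and "dominates (d + v - v') bs r bs' r'"
  shows "dominates d (fst (sink v bs)) (r + snd (sink v bs))
    (fst (sink v' bs')) (r' + snd (sink v' bs'))"
  using assms
proof (induction bs arbitrary: d v v' bs')
  case Nil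
  then show ?case by (cases bs') auto
next
  case (Cons b bs)
  then obtain b' cs where bs': "bs' = b' # cs" by (cases bs') auto
  define m m' where "m = (v + b) / 2" and "m' = (v' + b') / 2"
  have tail: "dominates (d + v - v' + b - b') bs r cs r'"
    using Cons.prems bs' by auto
  have eq: "d + v - v' + b - b' = (d + m - m') + m - m'"
    by (simp add: m_def m'_def field_simps)
  have "0 \<le> d + m - m'"
    using dominates_nonneg[OF tail] \<open>0 \<le> d\<close> unfolding eq by linarith
  from Cons.IH[OF this tail[unfolded eq]] show ?case
    using \<open>0 \<le> d\<close> by (simp add: bs' Let_def m_def m'_def)
qed

text \<open>With \<open>dominates_imp_le\<close>, the partially summed form of coefficients
  increasing downwards: water moved up can only lower the red total.\<close>

lemma dominates_settle:
  assumes "word_dominates d l l'"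
  shows "dominates d (fst (settle l)) (snd (settle l)) (fst (settle l')) (snd (settle l'))"
  using assms
proof (induction d l l' rule: word_dominates.induct)
  case (2 d k v l k' v' l')
  then show ?case using dominates_sink[of d v v'] by (auto simp: Let_def)
qed auto

lemma word_dominates_refl: "word_dominates 0 l l"
  by (induction l) auto

lemma word_dominates_append: "word_dominates 0 (p @ l) (p @ l') \<longleftrightarrow> word_dominates 0 l l'"
  by (induction p) auto

lemma settle_shift_up_le:
  assumes "u + v = u' + v'" and "u' \<le> u"
  shows "snd (settle (p @ (k, u) # (k', v) # q)) \<le> snd (settle (p @ (k, u') # (k', v') # q))"
proof -
  have "u - u' + v - v' = 0" using assms by simp
  then have "word_dominates 0 (p @ (k, u) # (k', v) # q) (p @ (k, u') # (k', v') # q)"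
    using assms(2) by (simp add: word_dominates_append word_dominates_refl)
  then show ?thesis by (blast intro: dominates_imp_le dominates_settle)
qed

text \<open>For unlike colours, the exchange turns red over blue into blue over red, both at the
  mean; then the colours match and \<open>settle_shift_up_le\<close> applies.\<close>

lemma settle_swap_le:
  assumes "u \<le> v"
  shows "snd (settle (p @ (k', v) # (k, u) # q)) \<le> snd (settle (p @ (k, u) # (k', v) # q))"
proof -
  define m where "m = (u + v) / 2"
  have m: "m = (v + u) / 2" "u \<le> m" "m \<le> v" using assms by (auto simp: m_def)
  consider "k = k'" | "k" "\<not> k'" | "\<not> k" "k'" by blast
  then show ?thesis
  proof cases
    case 1
    then show ?thesis using settle_shift_up_le[of v u u v] assms by simp
  next
    case 2
    then show ?thesis
      using settle_shift_up_le[of v u m m p False True q] settle_red_blue[OF m_def, of p q] m by simp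
  next
    case 3
    then show ?thesis
      using settle_shift_up_le[of m m u v p False True q] settle_red_blue[OF m(1), of p q] m by simp
  qed
qed

section \<open>Orderings of the tanks\<close>

definition is_red :: "tank \<Rightarrow> bool" where
  "is_red t \<longleftrightarrow> (\<exists>i. t = Red i)"

lemma is_red_simps [simp]: "is_red (Red i)" "\<not> is_red (Blue i)"
  by (auto simp: is_red_def)

definition settled :: "(tank \<Rightarrow> real) \<Rightarrow> tank list \<Rightarrow> real" where
  "settled x ts = snd (settle (map (\<lambda>t. (is_red t, x t)) ts))"

lemma settled_move_front_le:
  assumes "\<And>t. t \<in> set l \<Longrightarrow> x t \<le> x a"
  shows "settled x (p @ a # l @ q) \<le> settled x (p @ l @ a # q)"
  using assms
proof (induction l arbitrary: p)
  case (Cons t l)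
  have "settled x (p @ a # (t # l) @ q) \<le> settled x ((p @ [t]) @ a # l @ q)"
    using Cons.prems settle_swap_le[of "x t" "x a"] by (simp add: settled_def)
  also have "\<dots> \<le> settled x ((p @ [t]) @ l @ a # q)"
    by (rule Cons.IH) (use Cons.prems in auto)
  finally show ?case by simp
qed simp

text \<open>Selection sort: the head of \<open>ss\<close> is a fullest tank, so moving it to the
  front of \<open>ts\<close> cannot raise the value; \<open>p\<close> collects the tanks already
  placed.\<close>

lemma settled_sorted_le:
  assumes "sorted_wrt (\<lambda>s t. x t \<le> x s) ss" and "distinct ss" "distinct ts" "set ts = set ss"
  shows "settled x (p @ ss) \<le> settled x (p @ ts)"
  using assms
proof (induction ss arbitrary: p ts)
  case (Cons a ss)
  then obtain l q where ts: "ts = l @ a # q"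
    by (metis list.set_intros(1) split_list)
  have rest: "distinct (l @ q)" "set (l @ q) = set ss"
    using Cons.prems by (auto simp: ts)
  have "settled x (p @ a # ss) \<le> settled x (p @ a # l @ q)"
    using Cons.IH[of "l @ q" "p @ [a]"] Cons.prems rest by simp
  also have "\<dots> \<le> settled x (p @ ts)"
    unfolding ts using Cons.prems(1) rest(2) by (intro settled_move_front_le) auto
  finally show ?case .
qed simp

section \<open>One equilibration of neighbours\<close>

lemma equil_commute: "equil a b x = equil b a x"
  by (auto simp: equil_def add.commute)

lemma map_levels_equil:
  "a \<notin> set p \<Longrightarrow> b \<notin> set p \<Longrightarrow>
    map (\<lambda>t. (is_red t, equil a b x t)) p = map (\<lambda>t. (is_red t, x t)) p"
  by (auto simp: equil_def)

lemma settled_equil_red_blue: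
  assumes "distinct (p @ a # b # q)" "is_red a" "\<not> is_red b"
  shows "settled x (p @ a # b # q) = settled (equil a b x) (p @ b # a # q)"
  using assms settle_red_blue[OF refl, of _ "x a" "x b"]
  by (simp add: settled_def map_levels_equil) (simp add: equil_def)

lemma settled_equil_neighbours:
  assumes "distinct (p @ a # b # q)"
    and "is_red a \<and> \<not> is_red b \<or> (is_red a \<longleftrightarrow> is_red b) \<and> x b \<le> x a"
  shows "settled x (p @ a # b # q) \<le> settled (equil a b x) (p @ a # b # q)"
proof (cases "is_red a \<and> \<not> is_red b")
  case True
  then have "settled x (p @ a # b # q) = settled (equil a b x) (p @ b # a # q)"
    using assms(1) by (intro settled_equil_red_blue) auto
  \<comment> \<open>The two levels now agree, so restoring the order is harmless.\<close>
  also have "\<dots> \<le> settled (equil a b x) (p @ a # b # q)"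
    using settled_move_front_le[of "[a]" "equil a b x" b p q] by (simp add: equil_def)
  finally show ?thesis .
next
  case False
  then have "x b \<le> x a" using assms(2) by blast
  then show ?thesis
    using assms(1) settle_shift_up_le[of "x a" "x b" "(x a + x b) / 2" "(x a + x b) / 2"]
    by (simp add: settled_def map_levels_equil) (simp add: equil_def)
qed

section \<open>Sorted orderings and the invariant\<close>

lemma sorted_ordering_exists:
  assumes "finite A"
  obtains ts where "distinct ts" "set ts = A" "sorted_wrt (\<lambda>s t. (x t :: real) \<le> x s) ts"
proof -
  obtain l where l: "distinct l" "set l = A" using finite_distinct_list[OF assms] by blast
  have "sorted_wrt (\<lambda>s t. x t \<le> x s) (sort_key (\<lambda>t. - x t) l)"
    using sorted_sort_key[of "\<lambda>t. - x t" l] by (simp add: sorted_wrt_map)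
  with l show ?thesis by (intro that[of "sort_key (\<lambda>t. - x t) l"]) auto
qed

text \<open>All other tanks level with \<open>a\<close> go below the pair, so ties cannot separate
  it.\<close>

lemma sorted_ordering_neighbours:
  assumes "finite A" "a \<in> A" "b \<in> A" "a \<noteq> b" "(x a :: real) = x b"
  obtains p q where "distinct (p @ a # b # q)" "set (p @ a # b # q) = A"
    "sorted_wrt (\<lambda>s t. x t \<le> x s) (p @ a # b # q)"
proof -
  obtain p where p: "distinct p" "set p = {t \<in> A - {a, b}. x t > x a}"
    "sorted_wrt (\<lambda>s t. x t \<le> x s) p"
    using sorted_ordering_exists[of "{t \<in> A - {a, b}. x t > x a}" x] assms(1) by auto
  obtain q where q: "distinct q" "set q = {t \<in> A - {a, b}. x t \<le> x a}"
    "sorted_wrt (\<lambda>s t. x t \<le> x s) q"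
    using sorted_ordering_exists[of "{t \<in> A - {a, b}. x t \<le> x a}" x] assms(1) by auto
  have above: "x a < x t" if "t \<in> set p" for t using that p(2) by blast
  have below: "x t \<le> x a" if "t \<in> set q" for t using that q(2) by blast
  have "a \<notin> set p" "b \<notin> set p" "a \<notin> set q" "b \<notin> set q" using p(2) q(2) by blast+
  moreover have "set p \<inter> set q = {}"
    using above below by fastforce
  ultimately have "distinct (p @ a # b # q)"
    using p(1) q(1) assms(4) by simp
  moreover have "set p \<union> set q = A - {a, b}" using p(2) q(2) by fastforce
  then have "set (p @ a # b # q) = A" using assms(2,3) by auto
  moreover have "x t \<le> x s" if "s \<in> set p" "t \<in> set q" for s t
    using above[OF that(1)] below[OF that(2)] by simp
  then have "sorted_wrt (\<lambda>s t. x t \<le> x s) (p @ a # b # q)"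
    using p(3) q(3) above below assms(5) by (simp add: sorted_wrt_append less_imp_le)
  ultimately show ?thesis by (rule that)
qed

text \<open>For finite \<open>A\<close>: the minimum over all orderings is at least
  \<open>c\<close>, said without forming it.\<close>

definition settled_bound :: "tank set \<Rightarrow> real \<Rightarrow> (tank \<Rightarrow> real) \<Rightarrow> bool" where
  "settled_bound A c x \<longleftrightarrow> (\<forall>ts. distinct ts \<and> set ts = A \<longrightarrow> c \<le> settled x ts)"

lemma settled_bound_equil:
  assumes "finite A" "a \<in> A" "b \<in> A" "a \<noteq> b" "settled_bound A c x"
  shows "settled_bound A c (equil a b x)"
proof -
  have main: "settled_bound A c (equil a b x)"
    if ab: "a \<in> A" "b \<in> A" "a \<noteq> b"
      and col: "is_red a \<and> \<not> is_red b \<or> (is_red a \<longleftrightarrow> is_red b) \<and> x b \<le> x a" for a b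
    unfolding settled_bound_def
  proof (intro allI impI)
    fix ts assume ts: "distinct ts \<and> set ts = A"
    have "equil a b x a = equil a b x b" by (simp add: equil_def)
    then obtain p q where pq: "distinct (p @ a # b # q)" "set (p @ a # b # q) = A"
      "sorted_wrt (\<lambda>s t. equil a b x t \<le> equil a b x s) (p @ a # b # q)"
      using sorted_ordering_neighbours[OF assms(1) ab] by metis
    \<comment> \<open>The list is sorted for the levels after the move, but the bound before the
      move covers every ordering.\<close>
    have "c \<le> settled x (p @ a # b # q)"
      using assms(5) pq by (simp add: settled_bound_def)
    also have "\<dots> \<le> settled (equil a b x) (p @ a # b # q)"
      using pq(1) col by (rule settled_equil_neighbours)
    also have "\<dots> \<le> settled (equil a b x) ts"
      using settled_sorted_le[OF pq(3,1), of ts "[]"] ts pq(2) by simp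
    finally show "c \<le> settled (equil a b x) ts" .
  qed
  \<comment> \<open>\<open>equil\<close> is symmetric, so the red tank, or for equal colours the
    fuller one, may be named first.\<close>
  consider "is_red a \<and> \<not> is_red b \<or> (is_red a \<longleftrightarrow> is_red b) \<and> x b \<le> x a"
    | "is_red b \<and> \<not> is_red a \<or> (is_red b \<longleftrightarrow> is_red a) \<and> x a \<le> x b"
    by linarith
  then show ?thesis
    using main[of a b] main[of b a] assms by cases (auto simp: equil_commute)
qed

lemma run_simps [simp]:
  "run [] x = x" "run ((a, b) # ops) x = run ops (equil a b x)"
  by (simp_all add: run_def)

lemma run_append: "run (ops @ ops') x = run ops' (run ops x)"
  by (simp add: run_def)

lemma settled_bound_run:
  assumes "finite A" "\<forall>(a, b) \<in> set ops. a \<noteq> b \<and> a \<in> A \<and> b \<in> A" "settled_bound A c x"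
  shows "settled_bound A c (run ops x)"
  using assms
proof (induction ops arbitrary: x)
  case (Cons op ops)
  then show ?case by (cases op) (auto intro: settled_bound_equil)
qed simp

section \<open>The value attained by the strategy\<close>

lemma settled_sink:
  assumes "distinct (p @ r # bs @ q)" "is_red r" "\<And>b. b \<in> set bs \<Longrightarrow> \<not> is_red b"
  shows "settled x (p @ r # bs @ q) = settled (run (map (Pair r) bs) x) (p @ bs @ r # q)"
  using assms
proof (induction bs arbitrary: p x)
  case (Cons b bs)
  have "settled x (p @ r # (b # bs) @ q) = settled (equil r b x) ((p @ [b]) @ r # bs @ q)"
    using Cons.prems settled_equil_red_blue[of p r b "bs @ q" x] by simp
  also have "\<dots> = settled (run (map (Pair r) (b # bs)) x) ((p @ [b]) @ bs @ r # q)"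
    using Cons.prems Cons.IH[of "p @ [b]"] by auto
  finally show ?case by simp
qed simp

text \<open>Reversed because the first red tank to move must stand directly above the blue ones; in
  the induction \<open>q\<close> receives those that have passed.\<close>

lemma settled_sink_all:
  assumes "distinct (rs @ bs @ q)" "\<And>r. r \<in> set rs \<Longrightarrow> is_red r"
    "\<And>b. b \<in> set bs \<Longrightarrow> \<not> is_red b"
  shows "settled x (rev rs @ bs @ q) =
    settled (run (concat (map (\<lambda>r. map (Pair r) bs) rs)) x) (bs @ rev rs @ q)"
  using assms
proof (induction rs arbitrary: q x)
  case (Cons r rs)
  have "settled x (rev (r # rs) @ bs @ q)
      = settled (run (map (Pair r) bs) x) (rev rs @ bs @ r # q)"
    using Cons.prems settled_sink[of "rev rs" r bs q x] by auto
  also have "\<dots> = settled (run (concat (map (\<lambda>r. map (Pair r) bs) (r # rs))) x)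
      (bs @ rev rs @ r # q)"
    using Cons.prems Cons.IH[of "r # q"] by (auto simp: run_append)
  finally show ?case by simp
qed simp

text \<open>No red tank stands above a blue one, so no exchange remains.\<close>

lemma settled_blues_reds:
  assumes "\<And>b. b \<in> set bs \<Longrightarrow> \<not> is_red b" "\<And>r. r \<in> set rs \<Longrightarrow> is_red r"
  shows "settled x (bs @ rs) = (\<Sum>r\<leftarrow>rs. x r)"
proof -
  have "settle (map (\<lambda>t. (is_red t, x t)) rs) = ([], \<Sum>r\<leftarrow>rs. x r)"
    using assms(2) by (induction rs) (auto simp: Let_def)
  with assms(1) show ?thesis
    unfolding settled_def by (induction bs) (auto simp: Let_def)
qed

section \<open>Conservation of water and the conclusion\<close>

lemma sum_equil:
  assumes "finite A" "a \<in> A" "b \<in> A" "a \<noteq> b"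
  shows "sum (equil a b x) A = sum x A"
proof -
  have split: "sum f A = f a + f b + sum f (A - {a, b})" for f :: "tank \<Rightarrow> real"
  proof -
    have "A = insert a (insert b (A - {a, b}))" using assms by auto
    then have "sum f A = sum f (insert a (insert b (A - {a, b})))" by simp
    also have "\<dots> = f a + f b + sum f (A - {a, b})" using assms by (simp add: add.assoc)
    finally show ?thesis .
  qed
  have "sum (equil a b x) (A - {a, b}) = sum x (A - {a, b})"
    by (rule sum.cong) (auto simp: equil_def)
  then show ?thesis using \<open>a \<noteq> b\<close> by (simp add: split) (simp add: equil_def)
qed

lemma sum_run:
  assumes "finite A" "\<forall>(a, b) \<in> set ops. a \<noteq> b \<and> a \<in> A \<and> b \<in> A"
  shows "sum (run ops x) A = sum x A"
  using assms(2)
proof (induction ops arbitrary: x)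
  case (Cons op ops)
  then show ?case by (cases op) (simp add: sum_equil assms(1))
qed simp

lemma finite_tanks: "finite (tanks n)"
  by (simp add: tanks_def)

lemma sum_tanks: "sum x (tanks n) = (\<Sum>i=1..n. x (Red i)) + blue_total n x"
proof -
  have "sum x (tanks n) = sum x (Red ` {1..n}) + sum x (Blue ` {1..n})"
    unfolding tanks_def by (rule sum.union_disjoint) auto
  then show ?thesis by (simp add: blue_total_def sum.reindex inj_on_def)
qed

lemma strategy_tanks: "\<forall>(a, b) \<in> set (strategy n). a \<noteq> b \<and> a \<in> tanks n \<and> b \<in> tanks n"
  by (auto simp: strategy_def tanks_def)

theorem mainTheorem4:
  fixes n :: nat and ops :: "(tank \<times> tank) list"
  assumes "n \<ge> 1"
    and "\<forall>(a, b) \<in> set ops. a \<noteq> b \<and> a \<in> tanks n \<and> b \<in> tanks n"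
  shows "blue_total n (run ops init) \<le> blue_total n (run (strategy n) init)"
proof -
  define rs bs where "rs = map Red [1..<n+1]" and "bs = map Blue [1..<n+1]"
  define c where "c = (\<Sum>i=1..n. run (strategy n) init (Red i))"
  have red: "\<And>r. r \<in> set rs \<Longrightarrow> is_red r" and blue: "\<And>b. b \<in> set bs \<Longrightarrow> \<not> is_red b"
    by (auto simp: rs_def bs_def)
  have dist: "distinct (rs @ bs)" and tanks: "set (rs @ bs) = tanks n"
    by (auto simp: rs_def bs_def tanks_def distinct_map inj_on_def)
  have final: "settled x (bs @ rev rs) = (\<Sum>i=1..n. x (Red i))" for x
  proof -
    have "settled x (bs @ rev rs) = (\<Sum>r\<leftarrow>rev rs. x r)"
      using red blue by (intro settled_blues_reds) auto
    also have "\<dots> = (\<Sum>r\<leftarrow>rs. x r)"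
      by (metis rev_map sum_list_rev)
    also have "\<dots> = (\<Sum>i\<leftarrow>[1..<n+1]. x (Red i))"
      by (simp add: rs_def o_def)
    also have "\<dots> = (\<Sum>i=1..n. x (Red i))"
      by (subst sum_list_distinct_conv_sum_set) (auto intro: sum.cong)
    finally show ?thesis .
  qed
  have "strategy n = concat (map (\<lambda>r. map (Pair r) bs) rs)"
    by (simp add: strategy_def rs_def bs_def o_def)
  \<comment> \<open>So \<open>c\<close> is the initial value for this ordering, which is sorted and
    hence minimal.\<close>
  then have start: "settled init (rev rs @ bs) = c"
    using settled_sink_all[of rs bs "[]" init] dist red blue final c_def by simp
  have sorted: "sorted_wrt (\<lambda>s t. init t \<le> init s) (rev rs @ bs)"
    by (auto simp: sorted_wrt_append rs_def bs_def rev_map sorted_wrt_map init_def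
        intro: sorted_wrt_mono_rel[of _ "\<lambda>_ _. True"])
  have "settled_bound (tanks n) c init"
    unfolding settled_bound_def
    using settled_sorted_le[OF sorted, of _ "[]"] start dist tanks by auto
  then have "settled_bound (tanks n) c (run ops init)"
    using finite_tanks assms(2) by (intro settled_bound_run)
  \<comment> \<open>With the blue tanks on top, the bound becomes one for the actual red
    total.\<close>
  then have "c \<le> (\<Sum>i=1..n. run ops init (Red i))"
    unfolding settled_bound_def final[symmetric]
    by (elim allE[of _ "bs @ rev rs"]) (use dist tanks in auto)
  moreover have "(\<Sum>i=1..n. run ops init (Red i)) + blue_total n (run ops init)
      = c + blue_total n (run (strategy n) init)"
    unfolding c_def sum_tanks[symmetric]
    by (simp only: sum_run[OF finite_tanks assms(2)] sum_run[OF finite_tanks strategy_tanks])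
  ultimately show ?thesis by linarith
qed

end
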